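(* Let $0\le a\le b$ and $d>0$, and let $\mathbf{D}=[\mathbf{A}\ \mathbf{B}]\in\mathbb{C}^{M\times N}$ be any dictionary in the set $\mathcal{D}(d,a,b)$, i.e., a dictionary with coherence $d$ that is the concatenation of a sub-dictionary $\mathbf{A}$ with coherence $a$ and a sub-dictionary $\mathbf{B}$ with coherence $b$. Define $$f(x)=\frac{(1+a)(1+b)-xb(1+a)}{x(d^2-ab)+a(1+b)},\qquad x_b=\frac{1+b}{b+d^2},$$ $$x_s=\begin{cases}1/d, & \text{if } a=b=d,\\[4pt] \dfrac{d\sqrt{(1+a)(1+b)}-a-ab}{d^2-ab}, & \text{otherwise,}\end{cases}$$ and $\hat{x}=\min\{x_b,x_s\}$. Let $\mathbf{y}\in\mathbb{C}^M$ and let $\mathbf{x}\in\mathbb{C}^N$ satisfy $\mathbf{y}=\mathbf{D}\mathbf{x}$. If $$\|\mathbf{x}\|_0<\frac{\hat{x}+f(\hat{x})}{2},$$ then $\mathbf{x}$ is the unique solution of the problem (P0): minimize $\|\mathbf{x}'\|_0$ over all $\mathbf{x}'\in\mathbb{C}^N$ subject to $\mathbf{y}=\mathbf{D}\mathbf{x}'$.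
   Context: A dictionary is a matrix $\mathbf{D}=[\mathbf{d}_1\ \ldots\ \mathbf{d}_N]\in\mathbb{C}^{M\times N}$ whose columns have unit $\ell_2$-norm and span $\mathbb{C}^M$. A sub-dictionary is a (nonempty) matrix with unit $\ell_2$-norm columns in $\mathbb{C}^M$, not required to span $\mathbb{C}^M$. The coherence of a matrix with unit-norm columns $\mathbf{d}_i$ is $\max_{i\ne j}|\mathbf{d}_i^H\mathbf{d}_j|$, and it is set to $0$ if there is only one column. $\mathcal{D}(d,a,b)$ denotes the set of dictionaries $\mathbf{D}=[\mathbf{A}\ \mathbf{B}]$ with coherence $d$, where the sub-dictionary $\mathbf{A}$ has coherence $a$ and the sub-dictionary $\mathbf{B}$ has coherence $b$; $\mathbf{A}$ and $\mathbf{B}$ need not be orthonormal bases and need not have the same number of columns. (Automatically $a,b\le d\le 1$.) $\|\mathbf{x}\|_0$ is the number of nonzero entries of $\mathbf{x}$. *)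

theory Defs
  imports "HOL-Analysis.Analysis"
begin

definition herm_inner :: "complex^'m \<Rightarrow> complex^'m \<Rightarrow> complex" where
  "herm_inner u v = (\<Sum>k\<in>UNIV. cnj (u $ k) * v $ k)"

text \<open>Index types are nonempty, so a matrix always has at least one column.\<close>

definition subdictionary :: "complex^'n^'m \<Rightarrow> bool" where
  "subdictionary D \<longleftrightarrow> (\<forall>j. norm (column j D) = 1)"

text \<open>The span below is over the complex scalars; the unqualified \<open>span\<close> would be the real one.\<close>

definition dictionary :: "complex^'n^'m \<Rightarrow> bool" where
  "dictionary D \<longleftrightarrow> subdictionary D \<and> vec.span (columns D) = UNIV"

definition coherence :: "complex^'n^'m \<Rightarrow> real" where
  "coherence D =
    (if CARD('n) = 1 then 0
     else Max {cmod (herm_inner (column i D) (column j D)) | i j. i \<noteq> j})"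

definition hconcat :: "'a^('p::finite)^'m \<Rightarrow> 'a^('q::finite)^'m \<Rightarrow> 'a^('p + 'q)^'m" where
  "hconcat A B = (\<chi> i j. case j of Inl k \<Rightarrow> A $ i $ k | Inr k \<Rightarrow> B $ i $ k)"

definition dict_set :: "real \<Rightarrow> real \<Rightarrow> real \<Rightarrow> (complex^('p::finite + 'q::finite)^'m) set" where
  "dict_set d a b =
    {D. dictionary D \<and> coherence D = d \<and>
        (\<exists>(A :: complex^'p^'m) (B :: complex^'q^'m).
           D = hconcat A B \<and>
           subdictionary A \<and> coherence A = a \<and>
           subdictionary B \<and> coherence B = b)}"

definition l0norm :: "complex^'n \<Rightarrow> nat" where
  "l0norm x = card {i. x $ i \<noteq> 0}"

definition P0_solutions :: "complex^'n^'m \<Rightarrow> complex^'m \<Rightarrow> (complex^'n) set" where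
  "P0_solutions D y = {x. is_arg_min l0norm (\<lambda>x'. y = D *v x') x}"

definition f_thr :: "real \<Rightarrow> real \<Rightarrow> real \<Rightarrow> real \<Rightarrow> real" where
  "f_thr d a b x =
    ((1 + a) * (1 + b) - x * b * (1 + a)) / (x * (d^2 - a * b) + a * (1 + b))"

definition x_b :: "real \<Rightarrow> real \<Rightarrow> real" where
  "x_b d b = (1 + b) / (b + d^2)"

definition x_s :: "real \<Rightarrow> real \<Rightarrow> real \<Rightarrow> real" where
  "x_s d a b =
    (if a = b \<and> b = d then 1 / d
     else (d * sqrt ((1 + a) * (1 + b)) - a - a * b) / (d^2 - a * b))"

definition x_hat :: "real \<Rightarrow> real \<Rightarrow> real \<Rightarrow> real" where
  "x_hat d a b = min (x_b d b) (x_s d a b)"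

end

(* A nonzero kernel vector v = (p, q) of [A B] satisfies the uncertainty relation
   (1 + a - a n_a) (1 + b - b n_b) <= n_a n_b d^2 whenever both factors are positive, where
   n_a and n_b count the nonzero entries of p and q. Solving for n_a gives n_a >= f(n_b),
   so n_a + n_b >= n_b + f(n_b). The substitution t = x (d^2 - a b) + a (1 + b) turns
   x + f(x) into an affine function of t + (d s)^2 / t with s = sqrt ((1 + a) (1 + b)),
   which is minimal at t = d s, that is x = x_s. As f(x_b) = 1, the cap x_b accounts for n_a
   being an integer: either n_a = 0 (and then n_b >= 1 + 1/b), or n_a >= 1. Hence every nonzero
   kernel vector has at least x_hat + f(x_hat) nonzero entries, and the difference of two
   solutions of y = D x is a kernel vector. *)
theory Submission
  imports Defs
begin

section \<open>Hermitian inner products and coherence\<close>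

lemma herm_inner_self: "herm_inner u u = complex_of_real ((norm u)\<^sup>2)"
proof -
  have "(norm u)\<^sup>2 = (\<Sum>k\<in>UNIV. (cmod (u $ k))\<^sup>2)"
    by (simp add: norm_vec_def L2_set_def sum_nonneg)
  then show ?thesis
    by (simp only: herm_inner_def of_real_sum complex_norm_square) (simp add: mult.commute)
qed

lemma herm_inner_mult_vec:
  "herm_inner u (D *v v) = (\<Sum>j\<in>UNIV. herm_inner u (column j D) * v $ j)"
proof -
  have "herm_inner u (D *v v) = (\<Sum>k\<in>UNIV. \<Sum>j\<in>UNIV. cnj (u $ k) * D $ k $ j * v $ j)"
    by (simp add: herm_inner_def matrix_vector_mult_def sum_distrib_left mult.assoc)
  also have "\<dots> = (\<Sum>j\<in>UNIV. \<Sum>k\<in>UNIV. cnj (u $ k) * D $ k $ j * v $ j)"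
    by (rule sum.swap)
  finally show ?thesis
    by (simp add: herm_inner_def column_def sum_distrib_right)
qed

lemma coherence_ge:
  fixes D :: "complex^('n::finite)^('m::finite)"
  assumes "i \<noteq> j"
  shows "cmod (herm_inner (column i D) (column j D)) \<le> coherence D"
proof -
  have "CARD('n) \<noteq> 1"
    using assms by (metis UNIV_I card_1_singletonE singletonD)
  moreover have "finite {cmod (herm_inner (column i D) (column j D)) | i j. i \<noteq> j}"
    by (rule finite_subset[of _ "(\<lambda>(i, j). cmod (herm_inner (column i D) (column j D))) ` UNIV"])
      auto
  ultimately show ?thesis
    unfolding coherence_def using assms by (auto intro!: Max_ge)
qed

text \<open>\<open>0 \<le> c\<close> settles the one-column case, where the coherence is 0 by
  convention.\<close>

lemma coherence_le:
  fixes D :: "complex^('n::finite)^('m::finite)"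
  assumes "0 \<le> c" and "\<And>i j. i \<noteq> j \<Longrightarrow> cmod (herm_inner (column i D) (column j D)) \<le> c"
  shows "coherence D \<le> c"
proof (cases "CARD('n) = 1")
  case False
  have "finite {cmod (herm_inner (column i D) (column j D)) | i j. i \<noteq> j}"
    by (rule finite_subset[of _ "(\<lambda>(i, j). cmod (herm_inner (column i D) (column j D))) ` UNIV"])
      auto
  moreover have "\<exists>i j :: 'n. i \<noteq> j"
    using False by (metis (full_types) UNIV_eq_I card_1_singleton_iff insertCI One_nat_def)
  ultimately show ?thesis
    unfolding coherence_def using False assms(2) by (subst if_not_P) (auto intro!: Max.boundedI)
qed (simp add: coherence_def assms(1))

section \<open>Block structure and counting of nonzero entries\<close>

lemma column_hconcat [simp]:
  "column (Inl k) (hconcat A B) = column k A"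
  "column (Inr l) (hconcat A B) = column l B"
  by (simp_all add: column_def hconcat_def vec_eq_iff)

lemma sum_UNIV_Plus:
  "(\<Sum>j\<in>UNIV. g j) = (\<Sum>k\<in>UNIV. g (Inl k)) + (\<Sum>l\<in>UNIV. g (Inr l))"
  for g :: "'p::finite + 'q::finite \<Rightarrow> 'r::comm_monoid_add"
  by (metis UNIV_Plus_UNIV comp_apply finite_class.finite_UNIV sum.Plus sum.cong)

lemma l0norm_Plus:
  fixes v :: "complex^('p::finite + 'q::finite)"
  shows "l0norm v = card {k. v $ Inl k \<noteq> 0} + card {l. v $ Inr l \<noteq> 0}"
proof -
  have "{i. v $ i \<noteq> 0} = {k. v $ Inl k \<noteq> 0} <+> {l. v $ Inr l \<noteq> 0}"
    by (auto simp: Plus_def image_iff) (metis sumE)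
  then show ?thesis
    by (simp add: l0norm_def card_Plus)
qed

lemma l0norm_diff_le: "l0norm (v - w) \<le> l0norm v + l0norm w"
  for v w :: "complex^('n::finite)"
proof -
  have "l0norm (v - w) \<le> card ({i. v $ i \<noteq> 0} \<union> {i. w $ i \<noteq> 0})"
    unfolding l0norm_def by (intro card_mono) auto
  also have "\<dots> \<le> l0norm v + l0norm w"
    unfolding l0norm_def by (rule card_Un_le)
  finally show ?thesis .
qed

section \<open>Bounds on the entries of a kernel vector\<close>

lemma sum_norm_le_card:
  fixes g :: "'k::finite \<Rightarrow> complex" and c r :: real
  assumes "0 \<le> c" and "\<And>k. c * cmod (g k) \<le> r"
  shows "c * (\<Sum>k\<in>UNIV. cmod (g k)) \<le> card {k. g k \<noteq> 0} * r"
proof -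
  have "(\<Sum>k\<in>UNIV. cmod (g k)) = (\<Sum>k | g k \<noteq> 0. cmod (g k))"
    by (rule sum.mono_neutral_right) auto
  then have "c * (\<Sum>k\<in>UNIV. cmod (g k)) = (\<Sum>k | g k \<noteq> 0. c * cmod (g k))"
    by (simp add: sum_distrib_left)
  also have "\<dots> \<le> card {k. g k \<noteq> 0} * r"
    using assms by (intro sum_bounded_above)
  finally show ?thesis .
qed

text \<open>Pairing \<open>D *v v = 0\<close> with the unit column \<open>i\<close> expresses
  \<open>v $ i\<close> through the other entries, weighted by inner products. Adding
  \<open>w i * cmod (v $ i)\<close> to both sides, for any choice of \<open>w i\<close>, completes
  the right-hand sum to all indices.\<close>

lemma kernel_entry_bound:
  fixes D :: "complex^('n::finite)^('m::finite)"
  assumes "D *v v = 0" and "norm (column i D) = 1"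
    and "\<And>j. j \<noteq> i \<Longrightarrow> cmod (herm_inner (column i D) (column j D)) \<le> w j"
  shows "(1 + w i) * cmod (v $ i) \<le> (\<Sum>j\<in>UNIV. w j * cmod (v $ j))"
proof -
  let ?h = "\<lambda>j. herm_inner (column i D) (column j D) * v $ j"
  have "(\<Sum>j\<in>UNIV. ?h j) = 0"
    using assms(1) by (simp flip: herm_inner_mult_vec) (simp add: herm_inner_def)
  moreover have "(\<Sum>j\<in>UNIV. ?h j) = v $ i + (\<Sum>j\<in>UNIV - {i}. ?h j)"
    by (subst sum.remove[of _ i]) (auto simp: herm_inner_self assms(2))
  ultimately have "v $ i = - (\<Sum>j\<in>UNIV - {i}. ?h j)"
    by (simp add: eq_neg_iff_add_eq_0)
  then have "cmod (v $ i) = cmod (\<Sum>j\<in>UNIV - {i}. ?h j)"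
    by simp
  also have "\<dots> \<le> (\<Sum>j\<in>UNIV - {i}. w j * cmod (v $ j))"
    using assms(3) by (intro sum_norm_le) (auto simp: norm_mult intro!: mult_right_mono)
  finally show ?thesis
    by (subst sum.remove[of _ i]) (auto simp: algebra_simps)
qed

text \<open>The entry bound depends on an index only through its block, so summing it over the
  support of one block of \<open>v\<close> bounds the l1 norm of that block.\<close>

lemma hconcat_kernel_bounds:
  fixes A :: "complex^('p::finite)^('m::finite)" and B :: "complex^('q::finite)^'m"
  assumes "hconcat A B *v v = 0" and "subdictionary A" and "subdictionary B"
    and "0 \<le> coherence A" and "0 \<le> coherence B"
  defines "P \<equiv> \<Sum>k\<in>UNIV. cmod (v $ Inl k)" and "Q \<equiv> \<Sum>l\<in>UNIV. cmod (v $ Inr l)"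
    and "d \<equiv> coherence (hconcat A B)"
  shows "(1 + coherence A) * P \<le> card {k. v $ Inl k \<noteq> 0} * (coherence A * P + d * Q)"
    and "(1 + coherence B) * Q \<le> card {l. v $ Inr l \<noteq> 0} * (coherence B * Q + d * P)"
proof -
  have cross: "cmod (herm_inner (column k A) (column l B)) \<le> d"
    "cmod (herm_inner (column l B) (column k A)) \<le> d" for k l
    using coherence_ge[of "Inl k" "Inr l" "hconcat A B"]
      coherence_ge[of "Inr l" "Inl k" "hconcat A B"] by (simp_all add: d_def)
  have "(1 + coherence A) * cmod (v $ Inl k) \<le> coherence A * P + d * Q" for k
  proof -
    \<comment> \<open>The row's own index also gets weight \<open>coherence A\<close>, so the
      weighted sum is exactly \<open>coherence A * P + d * Q\<close>.\<close>
    let ?w = "case_sum (\<lambda>_. coherence A) (\<lambda>_. d)"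
    have "cmod (herm_inner (column (Inl k) (hconcat A B)) (column j (hconcat A B))) \<le> ?w j"
      if "j \<noteq> Inl k" for j
      using that by (cases j) (auto simp: cross coherence_ge)
    from kernel_entry_bound[OF assms(1) _ this] show ?thesis
      using assms(2) by (simp add: sum_UNIV_Plus P_def Q_def sum_distrib_left subdictionary_def)
  qed
  then show "(1 + coherence A) * P \<le> card {k. v $ Inl k \<noteq> 0} * (coherence A * P + d * Q)"
    unfolding P_def using assms(4) by (intro sum_norm_le_card) auto
  have "(1 + coherence B) * cmod (v $ Inr l) \<le> coherence B * Q + d * P" for l
  proof -
    let ?w = "case_sum (\<lambda>_. d) (\<lambda>_. coherence B)"
    have "cmod (herm_inner (column (Inr l) (hconcat A B)) (column j (hconcat A B))) \<le> ?w j"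
      if "j \<noteq> Inr l" for j
      using that by (cases j) (auto simp: cross coherence_ge)
    from kernel_entry_bound[OF assms(1) _ this] show ?thesis
      using assms(3)
      by (simp add: sum_UNIV_Plus P_def Q_def sum_distrib_left subdictionary_def add.commute)
  qed
  then show "(1 + coherence B) * Q \<le> card {l. v $ Inr l \<noteq> 0} * (coherence B * Q + d * P)"
    unfolding Q_def using assms(5) by (intro sum_norm_le_card) auto
qed

text \<open>Multiplying the two block bounds cancels \<open>P * Q\<close> and leaves a relation
  linear in \<open>m\<close>. Solving it for \<open>m\<close> divides by the denominator of
  \<open>f_thr\<close>, whence the positivity assumption.\<close>

lemma f_thr_le_of_uncertainty:
  fixes a b d m n P Q :: real
  assumes "0 \<le> a" "0 \<le> b" "0 \<le> m" "0 \<le> P" "0 \<le> Q" "0 < P + Q" "0 \<le> n" "0 \<le> d"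
    and P: "(1 + a) * P \<le> m * (a * P + d * Q)"
    and Q: "(1 + b) * Q \<le> n * (b * Q + d * P)"
    and t: "0 < n * (d\<^sup>2 - a * b) + a * (1 + b)"
  shows "f_thr d a b n \<le> m"
proof -
  define \<alpha> \<beta> where "\<alpha> = 1 + a - a * m" and "\<beta> = 1 + b - b * n"
  have \<alpha>: "\<alpha> * P \<le> m * d * Q" and \<beta>: "\<beta> * Q \<le> n * d * P"
    using P Q by (simp_all add: \<alpha>_def \<beta>_def algebra_simps)
  \<comment> \<open>This is \<open>\<alpha> * \<beta> \<le> m * n * d\<^sup>2\<close> with the terms
    in \<open>m\<close> collected on the right. If \<open>\<beta> \<le> 0\<close>, the signs of the
    two sides suffice.\<close>
  have "(1 + a) * \<beta> \<le> m * (n * (d\<^sup>2 - a * b) + a * (1 + b))"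
  proof (cases "\<beta> \<le> 0")
    case True
    then have "(1 + a) * \<beta> \<le> 0"
      using \<open>0 \<le> a\<close> by (simp add: mult_nonneg_nonpos)
    also have "0 \<le> m * (n * (d\<^sup>2 - a * b) + a * (1 + b))"
      using t \<open>0 \<le> m\<close> by simp
    finally show ?thesis .
  next
    case False
    have "\<alpha> * \<beta> \<le> m * n * d\<^sup>2"
    proof (cases "\<alpha> \<le> 0")
      case True
      then have "\<alpha> * \<beta> \<le> 0"
        using False by (simp add: mult_nonpos_nonneg)
      also have "0 \<le> m * n * d\<^sup>2"
        using assms by simp
      finally show ?thesis .
    next
      case \<alpha>_pos: False
      \<comment> \<open>As \<open>\<alpha>\<close> and \<open>\<beta>\<close> are positive, either
        of \<open>P\<close>, \<open>Q\<close> vanishing would force the other to vanish, against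
        \<open>0 < P + Q\<close>.\<close>
      have "P \<noteq> 0"
        using \<beta> False assms by (auto simp: mult_le_0_iff)
      moreover have "Q \<noteq> 0"
        using \<alpha> \<alpha>_pos assms by (auto simp: mult_le_0_iff)
      ultimately have PQ: "0 < P * Q"
        using assms by simp
      have "(\<alpha> * P) * (\<beta> * Q) \<le> (m * d * Q) * (n * d * P)"
        using False assms by (intro mult_mono[OF \<alpha> \<beta>]) auto
      then have "(\<alpha> * \<beta>) * (P * Q) \<le> (m * n * d\<^sup>2) * (P * Q)"
        by (simp add: power2_eq_square mult_ac)
      then show ?thesis
        using PQ by (rule mult_right_le_imp_le)
    qed
    then show ?thesis
      by (simp add: \<alpha>_def \<beta>_def algebra_simps)
  qed
  then show ?thesis
    using t by (simp add: f_thr_def \<beta>_def pos_divide_le_eq algebra_simps)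
qed

section \<open>Monotonicity and minimum of the threshold sum\<close>

lemma add_f_thr_eq:
  fixes a b d x :: real
  defines "c \<equiv> d\<^sup>2 - a * b" and "t \<equiv> x * (d\<^sup>2 - a * b) + a * (1 + b)"
  assumes "c \<noteq> 0" "t \<noteq> 0"
  shows "x + f_thr d a b x = (t + d\<^sup>2 * ((1 + a) * (1 + b)) / t - (a * (1 + b) + b * (1 + a))) / c"
proof -
  \<comment> \<open>Scaling by \<open>c\<close> makes the numerator of \<open>f_thr\<close> affine
    in \<open>t\<close>, so dividing by \<open>t\<close> leaves a multiple of \<open>1 / t\<close>
    and a constant.\<close>
  have "t * (c * f_thr d a b x) = c * ((1 + a) * (1 + b) - x * b * (1 + a))"
    using \<open>t \<noteq> 0\<close> by (simp add: f_thr_def t_def)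
  also have "\<dots> = d\<^sup>2 * ((1 + a) * (1 + b)) - b * (1 + a) * t"
    unfolding t_def c_def by algebra
  finally have "c * f_thr d a b x = d\<^sup>2 * ((1 + a) * (1 + b)) / t - b * (1 + a)"
    using \<open>t \<noteq> 0\<close> by (simp add: field_simps)
  moreover have "c * x = t - a * (1 + b)"
    by (simp add: t_def c_def)
  ultimately have "c * (x + f_thr d a b x)
      = t + d\<^sup>2 * ((1 + a) * (1 + b)) / t - (a * (1 + b) + b * (1 + a))"
    by (simp add: distrib_left)
  then show ?thesis
    using \<open>c \<noteq> 0\<close> by (simp add: field_simps)
qed

text \<open>The difference of the two values factors with \<open>r\<^sup>2 - t * u\<close>, which is
  nonnegative on the branch up to \<open>r\<close>. This serves the case where \<open>x_b\<close>
  lies to the left of the minimiser \<open>x_s\<close>.\<close>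

lemma add_square_div_antimono:
  fixes r t u :: real
  assumes "0 < t" "t \<le> u" "u \<le> r"
  shows "u + r\<^sup>2 / u \<le> t + r\<^sup>2 / t"
proof -
  have "t * u \<le> r\<^sup>2"
    unfolding power2_eq_square using assms by (intro mult_mono) auto
  then have "0 \<le> (u - t) * (r\<^sup>2 - t * u) / (t * u)"
    using assms by simp
  also have "\<dots> = (t + r\<^sup>2 / t) - (u + r\<^sup>2 / u)"
    using assms by (simp add: field_simps)
  finally show ?thesis by simp
qed

text \<open>The difference is the square \<open>(t - r)\<^sup>2\<close> over \<open>t\<close>. The
  left side stays unsimplified to match the threshold formula at \<open>t = r\<close>.\<close>

lemma add_square_div_ge:
  fixes r t :: real
  assumes "0 < t" "0 < r"
  shows "r + r\<^sup>2 / r \<le> t + r\<^sup>2 / t"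
proof -
  have "0 \<le> (t - r)\<^sup>2 / t"
    using assms by simp
  also have "\<dots> = (t + r\<^sup>2 / t) - (r + r\<^sup>2 / r)"
    using assms by (simp add: field_simps power2_eq_square)
  finally show ?thesis by simp
qed

text \<open>Substituting \<open>x_b d b * (b + d\<^sup>2)\<close> for \<open>1 + b\<close> turns
  numerator and denominator into the same product.\<close>

lemma f_thr_x_b:
  assumes "0 \<le> a" "0 \<le> b" "0 < d"
  shows "f_thr d a b (x_b d b) = 1"
proof -
  have pos: "0 < b + d\<^sup>2"
    using assms by (simp add: add_nonneg_pos)
  have x: "x_b d b * (b + d\<^sup>2) = 1 + b"
    using pos by (simp add: x_b_def)
  have "0 < x_b d b"
    using pos assms by (simp add: x_b_def)
  have num: "(1 + a) * (1 + b) - x_b d b * b * (1 + a) = (1 + a) * (d\<^sup>2 * x_b d b)"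
    unfolding x[symmetric] by (simp add: algebra_simps)
  have den: "x_b d b * (d\<^sup>2 - a * b) + a * (1 + b) = (1 + a) * (d\<^sup>2 * x_b d b)"
    unfolding x[symmetric] by (simp add: algebra_simps)
  show ?thesis
    unfolding f_thr_def num den using \<open>0 < x_b d b\<close> assms by simp
qed

text \<open>The real-number core: \<open>m\<close>, \<open>n\<close> stand for the support sizes of
  the two blocks of a kernel vector and \<open>P\<close>, \<open>Q\<close> for their l1
  norms.\<close>

lemma kernel_sparsity_bound:
  fixes a b d P Q :: real and m n :: nat
  assumes "0 \<le> a" "a \<le> b" "b \<le> d" "0 < d" "0 \<le> P" "0 \<le> Q" "0 < P + Q"
    and P: "(1 + a) * P \<le> m * (a * P + d * Q)"
    and Q: "(1 + b) * Q \<le> n * (b * Q + d * P)"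
  shows "x_hat d a b + f_thr d a b (x_hat d a b) \<le> m + n"
proof (cases "a = b \<and> b = d")
  case True
  \<comment> \<open>Here \<open>d\<^sup>2 - a * b\<close> is 0, so \<open>f_thr\<close> is affine
    with slope -1 and the sum agrees at \<open>n\<close> and at \<open>x_hat d a b\<close>.\<close>
  have const: "x + f_thr d a b x = 1 + 1 / d" for x
  proof -
    have "f_thr d a b x = (1 + d) * (1 + d - x * d) / ((1 + d) * d)"
      using True by (simp add: f_thr_def power2_eq_square algebra_simps)
    also have "\<dots> = (1 + d - x * d) / d"
      using \<open>0 < d\<close> by (subst mult_divide_mult_cancel_left) auto
    finally show ?thesis
      using \<open>0 < d\<close> by (simp add: field_simps)
  qed
  have "f_thr d a b n \<le> m"
    using assms True by (intro f_thr_le_of_uncertainty[of _ _ _ P Q]) (auto simp: power2_eq_square)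
  then show ?thesis
    using const[of n] const[of "x_hat d a b"] by linarith
next
  case False
  define c t r where "c = d\<^sup>2 - a * b"
    and "t = (\<lambda>x. x * (d\<^sup>2 - a * b) + a * (1 + b))"
    and "r = d * sqrt ((1 + a) * (1 + b))"
  have "0 \<le> b" using assms by simp
  \<comment> \<open>Since \<open>a \<le> b \<le> d\<close>, equality would force
    \<open>a = b = d\<close>, the case already settled.\<close>
  have "a * b < d * d"
  proof (cases "a < d")
    case True
    then show ?thesis
      using assms by (intro mult_less_le_imp_less le_less_trans[OF mult_left_mono[of b d a]]
          mult_strict_right_mono) auto
  qed (use False assms in auto)
  then have c: "0 < c" by (simp add: c_def power2_eq_square)
  have "0 < r" using assms by (simp add: r_def)
  have r2: "r\<^sup>2 = d\<^sup>2 * ((1 + a) * (1 + b))"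
    using assms by (simp add: r_def power_mult_distrib)
  have "x_s d a b = (r - a * (1 + b)) / c"
    using False by (auto simp: x_s_def r_def c_def algebra_simps)
  then have x_s: "t (x_s d a b) = r"
    using c by (simp add: t_def flip: c_def)
  have F: "x + f_thr d a b x = (t x + r\<^sup>2 / t x - (a * (1 + b) + b * (1 + a))) / c"
    if "0 < t x" for x
    using add_f_thr_eq[of d a b x] that c by (simp add: t_def c_def r2)
  have t_le: "t x \<le> t x' \<longleftrightarrow> x \<le> x'" for x x'
    using c by (simp add: t_def c_def)
  \<comment> \<open>This rules out \<open>t n = 0\<close>: with \<open>n = a = 0\<close> the second
    bound gives \<open>Q = 0\<close>, and then the first gives \<open>P = 0\<close>.\<close>
  have "n \<noteq> 0 \<or> a \<noteq> 0"
  proof (rule ccontr)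
    assume "\<not> ?thesis"
    then have "n = 0" "a = 0" by auto
    then have "(1 + b) * Q \<le> 0" using Q by simp
    then have "Q = 0" using \<open>0 \<le> b\<close> \<open>0 \<le> Q\<close> by (auto simp: mult_le_0_iff)
    then show False using P \<open>a = 0\<close> \<open>0 < P + Q\<close> by simp
  qed
  then have tn: "0 < t n"
  proof
    assume "n \<noteq> 0"
    then show ?thesis
      using c assms unfolding t_def c_def[symmetric] by (simp add: add_pos_nonneg)
  next
    assume "a \<noteq> 0"
    then show ?thesis
      using c assms unfolding t_def c_def[symmetric] by (simp add: add_nonneg_pos)
  qed
  have f_le: "f_thr d a b n \<le> m"
    using assms tn \<open>0 \<le> b\<close> unfolding t_def by (intro f_thr_le_of_uncertainty[of _ _ _ P Q]) auto
  show ?thesis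
  proof (cases "x_s d a b \<le> x_b d b")
    case True
    then have hat: "x_hat d a b = x_s d a b"
      by (simp add: x_hat_def)
    have "x_s d a b + f_thr d a b (x_s d a b) \<le> n + f_thr d a b n"
      using F[of "x_s d a b"] F[of n] x_s \<open>0 < r\<close> tn c add_square_div_ge[OF tn \<open>0 < r\<close>]
      by (auto intro!: divide_right_mono)
    then show ?thesis using hat f_le by simp
  next
    case x_b_less: False
    then have hat: "x_hat d a b = x_b d b"
      by (simp add: x_hat_def)
    have fb: "f_thr d a b (x_b d b) = 1"
      using assms by (intro f_thr_x_b) auto
    consider "n \<le> x_b d b" | "x_b d b < n" "m \<noteq> 0" | "m = 0" by linarith
    then have "x_b d b + 1 \<le> m + n"
    proof cases
      case 1
      \<comment> \<open>Now \<open>n \<le> x_b < x_s\<close>, so both points lie on the decreasing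
        branch.\<close>
      have le: "t n \<le> t (x_b d b)" "t (x_b d b) \<le> r"
        using 1 x_b_less t_le x_s[symmetric] by simp_all
      then have "0 < t (x_b d b)" using tn by linarith
      then have "x_b d b + f_thr d a b (x_b d b) \<le> n + f_thr d a b n"
        using F[of "x_b d b"] F[of n] tn c add_square_div_antimono[OF tn le]
        by (auto intro!: divide_right_mono)
      then show ?thesis using fb f_le by simp
    next
      case 3
      then have "(1 + a) * P \<le> 0" using P by simp
      then have "P = 0" using \<open>0 \<le> a\<close> \<open>0 \<le> P\<close> by (auto simp: mult_le_0_iff)
      then have "(1 + b) * Q \<le> (n * b) * Q" "0 < Q"
        using Q \<open>0 < P + Q\<close> by (simp_all add: mult.assoc)
      then have nb: "1 + b \<le> n * b" by simp
      then have "b \<noteq> 0" by auto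
      then have "0 < b" using \<open>0 \<le> b\<close> by simp
      \<comment> \<open>From \<open>b \<le> d\<close> follows
        \<open>b * (1 + b) \<le> b + d\<^sup>2\<close>, that is \<open>x_b \<le> 1 / b\<close>,
        while \<open>nb\<close> says \<open>n \<ge> 1 + 1 / b\<close>.\<close>
      have "b * b \<le> d * d"
        using assms by (intro mult_mono) auto
      then have "x_b d b \<le> 1 / b"
        using \<open>0 < b\<close> by (simp add: x_b_def power2_eq_square divide_simps algebra_simps add_pos_nonneg)
      also have "\<dots> \<le> real n - 1"
        using nb \<open>0 < b\<close> by (simp add: field_simps)
      finally show ?thesis by simp
    qed auto
    then show ?thesis using hat fb by simp
  qed
qed

section \<open>Sparsity of dictionary kernels and uniqueness\<close>

lemma l0norm_kernel_ge:
  fixes D :: "complex^('p::finite + 'q::finite)^('m::finite)"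
  assumes "0 \<le> a" "a \<le> b" "0 < d" "D \<in> dict_set d a b" "D *v v = 0" "v \<noteq> 0"
  shows "x_hat d a b + f_thr d a b (x_hat d a b) \<le> l0norm v"
proof -
  obtain A :: "complex^'p^'m" and B :: "complex^'q^'m"
    where D: "D = hconcat A B" and sub: "subdictionary A" "subdictionary B"
      and coh: "coherence A = a" "coherence B = b" "coherence (hconcat A B) = d"
    using assms(4) unfolding dict_set_def by auto
  \<comment> \<open>Distinct columns of \<open>B\<close> are distinct columns of \<open>D\<close>,
    which supplies the bound \<open>b \<le> d\<close>.\<close>
  have "coherence B \<le> coherence (hconcat A B)"
    using coherence_ge[of "Inr i" "Inr j" "hconcat A B" for i j] coh \<open>0 < d\<close>
    by (intro coherence_le) auto
  then have "b \<le> d" using coh by simp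
  let ?P = "\<Sum>k\<in>UNIV. cmod (v $ Inl k)" and ?Q = "\<Sum>l\<in>UNIV. cmod (v $ Inr l)"
  obtain i where "v $ i \<noteq> 0"
    using \<open>v \<noteq> 0\<close> by (auto simp: vec_eq_iff)
  then have "0 < (\<Sum>j\<in>UNIV. cmod (v $ j))"
    by (intro sum_pos2[of _ i]) auto
  then have "0 < ?P + ?Q"
    by (simp add: sum_UNIV_Plus)
  moreover have "0 \<le> ?P" "0 \<le> ?Q"
    by (auto intro: sum_nonneg)
  ultimately show ?thesis
    using kernel_sparsity_bound[of a b d ?P ?Q] \<open>b \<le> d\<close> assms(1-3)
      hconcat_kernel_bounds[of A B v] assms(5) D sub coh
    by (simp add: l0norm_Plus)
qed

theorem mainTheorem2:
  fixes D :: "complex^('p::finite + 'q::finite)^('m::finite)"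
    and a b d :: real
    and x :: "complex^('p + 'q)"
    and y :: "complex^'m"
  assumes "0 \<le> a" and "a \<le> b" and "d > 0"
    and "D \<in> dict_set d a b"
    and "y = D *v x"
    and "real (l0norm x) < (x_hat d a b + f_thr d a b (x_hat d a b)) / 2"
  shows "P0_solutions D y = {x}"
proof -
  \<comment> \<open>Strictness against every other feasible vector yields both minimality and
    uniqueness.\<close>
  have less: "l0norm x < l0norm x'" if "y = D *v x'" "x' \<noteq> x" for x'
  proof -
    have "D *v (x - x') = 0"
      using that assms(5) by (simp add: matrix_vector_mult_diff_distrib)
    then have "x_hat d a b + f_thr d a b (x_hat d a b) \<le> l0norm (x - x')"
      using that(2) assms(1-4) by (intro l0norm_kernel_ge) auto
    also have "\<dots> \<le> real (l0norm x) + real (l0norm x')"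
      using l0norm_diff_le[of x x'] by linarith
    \<comment> \<open>The kernel bound exceeds \<open>2 * l0norm x\<close>, so \<open>x'\<close>
      must account for more than \<open>l0norm x\<close> entries.\<close>
    finally have "real (l0norm x) < real (l0norm x')" using assms(6) by argo
    then show ?thesis by simp
  qed
  show ?thesis
  proof (intro equalityI subsetI)
    fix x' assume "x' \<in> P0_solutions D y"
    then show "x' \<in> {x}"
      using less[of x'] assms(5) by (auto simp: P0_solutions_def is_arg_min_def)
  next
    fix x' assume "x' \<in> {x}"
    then show "x' \<in> P0_solutions D y"
      using less assms(5) by (auto simp: P0_solutions_def is_arg_min_def dest: less_asym)
  qed
qed

end
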